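(* Let $\sigma>0$. For $\theta\in\ell_2$ and $n\in\mathbb{N}$ let, under $P_\theta$, $X=(X_1,X_2,\dots)$ be a sequence of independent random variables with $X_i\sim N(\theta_i,\sigma^2/n)$, and let $\hat\theta^{(n)}$ be an initial estimator that is independent of $X$. Define $$R_{k,n}(\hat\theta^{(n)})=\sum_{i=1}^k(X_i-\hat\theta^{(n)}_i)^2-\frac{k\sigma^2}{n},\qquad \hat\tau_{k,n,\theta}^2=\frac{2k\sigma^4}{n^2}+\frac{4\sigma^2}{n}\sum_{i=1}^k(\theta_i-\hat\theta_i^{(n)})^2,\quad \hat\tau_{k,n,\theta}>0.$$ Then for any $k_n\to\infty$ as $n\to\infty$, $$\sup_{\theta\in\ell_2}\sup_{x\in\mathbb{R}}\left|P_\theta\left(\frac{R_{k_n,n}(\hat\theta^{(n)})-\sum_{i=1}^{k_n}(\theta_i-\hat\theta_i^{(n)})^2}{\hat\tau_{k_n,n,\theta}}\le x\ \Big|\ \hat\theta^{(n)}\right)-\Phi(x)\right|\to0,$$ where the convergence may be understood in the almost sure sense.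
   Context: $\ell_2$ is the space of square-summable real sequences $\theta=(\theta_1,\theta_2,\dots)$. $\Phi$ is the standard normal distribution function. The initial estimator $\hat\theta^{(n)}$ is a random element of $\ell_2$ based on data independent of $X$; the conditional probability given $\hat\theta^{(n)}$ is computed by treating $\hat\theta^{(n)}$ as fixed at its value and using only the law of $X$ under $\theta$. The $k_n$ are positive integers (with $k_n\le n$ in the finite sequence model, where $\theta$ is restricted to sequences with $\theta_i=0$ for $i>n$). *)

theory Defs
  imports "HOL-Probability.Probability"
begin

text \<open>
  Sequences are indexed from 0, so the coordinate written \<open>\<theta>\<^sub>i\<close> with \<open>i \<ge> 1\<close> in the usual notation
  is \<open>\<theta> (i - 1)\<close>, and a sum over \<open>i = 1, \<dots>, k\<close> is a sum over \<open>i < k\<close>.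
\<close>

definition ell2 :: "(nat \<Rightarrow> real) set" where
  "ell2 = {\<theta>. summable (\<lambda>i. (\<theta> i)\<^sup>2)}"

text \<open>
  The trace on \<open>ell2\<close> of the product sigma-algebra. Since \<open>\<ell>\<^sub>2\<close> is separable, this is the Borel
  sigma-algebra of the norm topology.
\<close>

definition ell2_borel :: "(nat \<Rightarrow> real) measure" where
  "ell2_borel = restrict_space (Pi\<^sub>M UNIV (\<lambda>_. borel)) ell2"

definition risk_stat :: "real \<Rightarrow> nat \<Rightarrow> nat \<Rightarrow> (nat \<Rightarrow> real) \<Rightarrow> (nat \<Rightarrow> real) \<Rightarrow> real" where
  "risk_stat \<sigma> k n x t = (\<Sum>i<k. (x i - t i)\<^sup>2) - real k * \<sigma>\<^sup>2 / real n"

definition tau_hat :: "real \<Rightarrow> nat \<Rightarrow> nat \<Rightarrow> (nat \<Rightarrow> real) \<Rightarrow> (nat \<Rightarrow> real) \<Rightarrow> real" where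
  "tau_hat \<sigma> k n \<theta> t =
     sqrt (2 * real k * \<sigma>^4 / (real n)\<^sup>2 + 4 * \<sigma>\<^sup>2 / real n * (\<Sum>i<k. (\<theta> i - t i)\<^sup>2))"

text \<open>
  The conditional probability of \<open>Q X T\<close> given \<open>T\<close>, evaluated at the outcome \<open>\<omega>\<close>: the value
  \<open>T \<omega>\<close> is frozen and only the law of \<open>X\<close> under \<open>M\<close> is used. Fixing this version for every
  \<open>\<omega>\<close> is needed to take suprema of conditional probabilities over uncountable index sets.
  The lemma below shows that it is a version of the conditional probability in the sense of
  \<open>real_cond_exp\<close> whenever \<open>T\<close> and \<open>X\<close> are independent.
\<close>

definition cond_prob_given ::
    "'w measure \<Rightarrow> ('w \<Rightarrow> 'x) \<Rightarrow> ('w \<Rightarrow> 't) \<Rightarrow> ('x \<Rightarrow> 't \<Rightarrow> bool) \<Rightarrow> 'w \<Rightarrow> real" where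
  "cond_prob_given M X T Q \<omega> = measure M {\<omega>' \<in> space M. Q (X \<omega>') (T \<omega>)}"

lemma (in prob_space) cond_prob_given_version:
  assumes ind: "indep_var MT T MX X"
    and Q: "{p \<in> space (MT \<Otimes>\<^sub>M MX). Q (snd p) (fst p)} \<in> sets (MT \<Otimes>\<^sub>M MX)"
  shows "AE \<omega> in M. real_cond_exp M (vimage_algebra (space M) T MT)
           (indicator {\<omega>' \<in> space M. Q (X \<omega>') (T \<omega>')}) \<omega> = cond_prob_given M X T Q \<omega>"
proof -
  have T[measurable]: "T \<in> M \<rightarrow>\<^sub>M MT" and X[measurable]: "X \<in> M \<rightarrow>\<^sub>M MX"
    and joint: "distr M MT T \<Otimes>\<^sub>M distr M MX X = distr M (MT \<Otimes>\<^sub>M MX) (\<lambda>\<omega>. (T \<omega>, X \<omega>))"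
    using ind by (auto simp: indep_var_distribution_eq)
  have TS: "T \<in> space M \<rightarrow> space MT" using measurable_space[OF T] by auto
  define F where "F = vimage_algebra (space M) T MT"
  define DT where "DT = distr M MT T"
  define DX where "DX = distr M MX X"
  define B where "B = {p \<in> space (MT \<Otimes>\<^sub>M MX). Q (snd p) (fst p)}"
  define g where "g t = measure DX (Pair t -` B)" for t
  interpret DX: prob_space DX unfolding DX_def by (rule prob_space_distr) simp
  interpret DT: prob_space DT unfolding DT_def by (rule prob_space_distr) simp
  interpret DTX: pair_prob_space DT DX by unfold_locales
  have B[measurable]: "B \<in> sets (MT \<Otimes>\<^sub>M MX)" using Q by (simp add: B_def)
  have setsD[simp, measurable_cong]: "sets DT = sets MT" "sets DX = sets MX"
    by (simp_all add: DT_def DX_def)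
  have B'[measurable]: "B \<in> sets (DT \<Otimes>\<^sub>M DX)"
    using B sets_pair_measure_cong[OF setsD] by simp
  have g[measurable]: "g \<in> borel_measurable MT"
    unfolding g_def measure_def
    using DX.measurable_emeasure_Pair[OF B'] by (simp cong: measurable_cong_sets)
  have F_sub: "subalgebra M F"
    unfolding F_def subalgebra_def
    by (auto simp: sets_vimage_algebra2[OF TS] intro: measurable_sets[OF T])
  interpret finite_measure_subalgebra M F by unfold_locales (rule F_sub)
  have TF: "T \<in> F \<rightarrow>\<^sub>M MT"
    unfolding F_def by (rule measurable_vimage_algebra1) (rule TS)
  have eq: "cond_prob_given M X T Q \<omega> = g (T \<omega>)" if "\<omega> \<in> space M" for \<omega>
  proof -
    have tB: "Pair (T \<omega>) -` B \<in> sets MX"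
      using B by (rule sets_Pair1)
    have "g (T \<omega>) = measure M (X -` (Pair (T \<omega>) -` B) \<inter> space M)"
      unfolding g_def DX_def by (rule measure_distr) (use tB in auto)
    also have "X -` (Pair (T \<omega>) -` B) \<inter> space M = {\<omega>' \<in> space M. Q (X \<omega>') (T \<omega>)}"
      using measurable_space[OF T that] measurable_space[OF X]
      by (auto simp: B_def space_pair_measure)
    finally show ?thesis by (simp add: cond_prob_given_def)
  qed
  have ind_eq: "indicator {\<omega>' \<in> space M. Q (X \<omega>') (T \<omega>')} \<omega> = (indicator B (T \<omega>, X \<omega>) :: real)"
    if "\<omega> \<in> space M" for \<omega>
    using that measurable_space[OF T that] measurable_space[OF X that]
    by (auto simp: B_def space_pair_measure indicator_def)
  have g_bd: "\<bar>g t\<bar> \<le> 1" for t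
    unfolding g_def by simp
  have main: "AE \<omega> in M. real_cond_exp M F (\<lambda>\<omega>. indicator B (T \<omega>, X \<omega>)) \<omega> = g (T \<omega>)"
  proof (rule real_cond_exp_charact)
    fix A assume "A \<in> sets F"
    then obtain C where C[measurable]: "C \<in> sets MT" and A: "A = T -` C \<inter> space M"
      unfolding F_def by (auto simp: sets_vimage_algebra2[OF TS])
    let ?h = "\<lambda>p. indicator C (fst p) * indicator B p :: real"
    have hm: "?h \<in> borel_measurable (MT \<Otimes>\<^sub>M MX)" by measurable
    have hi: "integrable (DT \<Otimes>\<^sub>M DX) ?h"
      by (rule DTX.P.integrable_const_bound[where B=1]) (auto simp: indicator_def)
    have "(\<integral>\<omega>\<in>A. indicator B (T \<omega>, X \<omega>) \<partial>M) = (\<integral>\<omega>. ?h (T \<omega>, X \<omega>) \<partial>M)"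
      unfolding set_lebesgue_integral_def
      by (rule Bochner_Integration.integral_cong) (auto simp: A indicator_def)
    also have "\<dots> = (\<integral>p. ?h p \<partial>distr M (MT \<Otimes>\<^sub>M MX) (\<lambda>\<omega>. (T \<omega>, X \<omega>)))"
      by (rule integral_distr[symmetric]) (use hm in auto)
    also have "\<dots> = (\<integral>p. ?h p \<partial>(DT \<Otimes>\<^sub>M DX))"
      by (simp add: joint DT_def DX_def)
    also have "\<dots> = (\<integral>t. (\<integral>x. ?h (t, x) \<partial>DX) \<partial>DT)"
      by (rule DTX.integral_fst'[symmetric]) (rule hi)
    also have "\<dots> = (\<integral>t. indicator C t * g t \<partial>DT)"
    proof (rule Bochner_Integration.integral_cong)
      fix t
      have "(\<integral>x. ?h (t, x) \<partial>DX) = indicator C t * (\<integral>x. indicator (Pair t -` B) x \<partial>DX)"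
        by (simp add: indicator_def)
      also have "(\<integral>x. indicator (Pair t -` B) x \<partial>DX) = g t"
        unfolding g_def using sets_Pair1[OF B, of t]
        by (subst Bochner_Integration.integral_indicator) (auto simp: Int_absorb2 sets.sets_into_space)
      finally show "(\<integral>x. ?h (t, x) \<partial>DX) = indicator C t * g t" .
    qed simp
    also have "\<dots> = (\<integral>\<omega>. indicator C (T \<omega>) * g (T \<omega>) \<partial>M)"
      unfolding DT_def by (rule integral_distr) auto
    also have "\<dots> = (\<integral>\<omega>\<in>A. g (T \<omega>) \<partial>M)"
      unfolding set_lebesgue_integral_def
      by (rule Bochner_Integration.integral_cong) (auto simp: A indicator_def)
    finally show "(\<integral>\<omega>\<in>A. indicator B (T \<omega>, X \<omega>) \<partial>M) = (\<integral>\<omega>\<in>A. g (T \<omega>) \<partial>M)" .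
  next
    show "integrable M (\<lambda>\<omega>. indicator B (T \<omega>, X \<omega>) :: real)"
      by (rule integrable_const_bound[where B=1]) (auto simp: indicator_def)
    show "integrable M (\<lambda>\<omega>. g (T \<omega>))"
      by (rule integrable_const_bound[where B=1]) (use g_bd in auto)
    show "(\<lambda>\<omega>. g (T \<omega>)) \<in> borel_measurable F"
      using TF g by (rule measurable_compose)
  qed
  have "AE \<omega> in M. real_cond_exp M F (indicator {\<omega>' \<in> space M. Q (X \<omega>') (T \<omega>')}) \<omega>
          = real_cond_exp M F (\<lambda>\<omega>. indicator B (T \<omega>, X \<omega>)) \<omega>"
  proof (rule real_cond_exp_cong)
    show "AE \<omega> in M. indicator {\<omega>' \<in> space M. Q (X \<omega>') (T \<omega>')} \<omega> = (indicator B (T \<omega>, X \<omega>) :: real)"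
      by (rule AE_I2) (rule ind_eq)
    have "(indicator {\<omega>' \<in> space M. Q (X \<omega>') (T \<omega>')} :: _ \<Rightarrow> real) \<in> borel_measurable M
        \<longleftrightarrow> (\<lambda>\<omega>. indicator B (T \<omega>, X \<omega>) :: real) \<in> borel_measurable M"
      by (rule measurable_cong) (rule ind_eq)
    then show "(indicator {\<omega>' \<in> space M. Q (X \<omega>') (T \<omega>')} :: _ \<Rightarrow> real) \<in> borel_measurable M"
      by simp
  qed simp
  moreover have "AE \<omega> in M. cond_prob_given M X T Q \<omega> = g (T \<omega>)"
    by (rule AE_I2) (rule eq)
  ultimately show ?thesis
    using main unfolding F_def by eventually_elim simp
qed

end

theory Submission
  imports Defs
begin

text \<open>
  Write \<open>s = \<sigma> / sqrt n\<close>, \<open>Z\<^sub>i = (X\<^sub>i - \<theta>\<^sub>i) / s\<close> and \<open>a\<^sub>i = (\<theta>\<^sub>i - t\<^sub>i) / s\<close>, where \<open>t\<close> is the value at which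
  the initial estimator is held fixed. Dividing numerator and denominator by \<open>s\<^sup>2\<close> turns the
  normalized error into \<open>W = (\<Sum>i<k. Z\<^sub>i\<^sup>2 - 1 + 2 a\<^sub>i Z\<^sub>i) / \<tau>\<close> with \<open>\<tau>\<^sup>2 = 2 k + 4 (\<Sum>i<k. a\<^sub>i\<^sup>2)\<close> and
  independent standard normal \<open>Z\<^sub>i\<close>. So it suffices to show that \<open>W\<close> is asymptotically standard
  normal uniformly in the coefficients \<open>a\<close>, which is uniformity in \<open>\<theta>\<close> whatever the value \<open>t\<close>; the
  convergence then holds at every outcome.

  Lindeberg's condition may fail for this sum, as a single large coefficient can dominate it. But a
  dominating term is then almost exactly \<open>2 a\<^sub>i Z\<^sub>i\<close>, which is Gaussian already. Accordingly, the
  characteristic function of a single term is expanded in powers of the factor \<open>u\<close> of \<open>Z\<^sup>2 - 1\<close>, and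
  the Gaussian factor \<open>exp (\<i> b Z)\<close> stays exact in the leading term. The outcome, lemma \<open>char_noncentral_square_approx\<close>, is
  that \<open>E exp (\<i> (u (Z\<^sup>2 - 1) + b Z))\<close> differs from \<open>exp (- u\<^sup>2 - b\<^sup>2 / 2)\<close> by at most a multiple of
  \<open>\<bar>u\<bar>\<^sup>3 + \<bar>u\<bar> b\<^sup>2\<close>. This is quadratic in \<open>b\<close>, so with \<open>u = t / \<tau>\<close> and \<open>b = 2 u a\<^sub>i\<close> the errors add up
  to a multiple of \<open>\<bar>u\<bar>\<^sup>3 \<tau>\<^sup>2 = \<bar>t\<bar>\<^sup>3 / \<tau>\<close>, which is \<open>O(1 / sqrt k)\<close> whatever \<open>a\<close> is
  (lemma \<open>char_quadratic_form_approx\<close>).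

  Levy's continuity theorem turns this into weak convergence along any sequence of coefficients,
  and because the normal distribution function is continuous, the distribution functions even
  converge uniformly (lemma \<open>weak_conv_m_imp_uniform_limit_cdf\<close>). The supremum over \<open>\<theta>\<close> is
  reached through sequences: it tends to zero as soon as the quantity tends to zero along every
  choice of one \<open>\<theta>\<close> for each \<open>n\<close> (lemma \<open>tendsto_SUP_zeroI\<close>).
\<close>

section \<open>The characteristic function of a noncentral square\<close>

text \<open>
  The approximation keeps the factor \<open>iexp (b * z)\<close> exactly at order zero in \<open>u\<close>, linearizes it at
  order one and replaces it by 1 at order two. Any less at order one would leave an error of order
  \<open>\<bar>u\<bar> \<bar>b\<bar>\<close>, which is too large to be summed over the coordinates. The mixed error
  \<open>u\<^sup>2 \<bar>b\<bar>\<close> is absorbed by the inequality between arithmetic and geometric means.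
\<close>

lemma norm_iexp_quadratic_expansion_le:
  fixes u b z :: real
  defines "y \<equiv> z\<^sup>2 - 1"
  shows "norm (iexp (u * y + b * z) -
            (iexp (b * z) + \<i> * of_real (u * y) - of_real (u * b * (y * z)) - of_real (u\<^sup>2 / 2 * y\<^sup>2)))
         \<le> (\<bar>u\<bar> ^ 3 + \<bar>u\<bar> * b\<^sup>2) * (1 + z\<^sup>2) ^ 3"
    (is "norm (_ - ?A) \<le> _")
proof -
  define w where "w = 1 + z\<^sup>2"
  have w1: "1 \<le> w" by (simp add: w_def)
  have yw: "\<bar>y\<bar> \<le> w" by (simp add: w_def y_def abs_if)
  have zw: "\<bar>z\<bar> \<le> w"
  proof -
    have "0 \<le> (\<bar>z\<bar> - 1)\<^sup>2" by simp
    then have "2 * \<bar>z\<bar> \<le> 1 + z\<^sup>2" by (simp add: power2_diff)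
    then show ?thesis by (simp add: w_def)
  qed
  have z2w: "z\<^sup>2 \<le> w" by (simp add: w_def)
  define e0 where "e0 = iexp (b * z) - 1"
  define e1 where "e1 = iexp (b * z) - (1 + \<i> * of_real (b * z))"
  define e2 where "e2 = iexp (u * y) - (1 + \<i> * of_real (u * y) - of_real ((u * y)\<^sup>2 / 2))"
  have n0: "norm e0 \<le> \<bar>b * z\<bar>"
    using iexp_approx1[of "b * z" 0] by (simp add: e0_def)
  have n1: "norm e1 \<le> (b * z)\<^sup>2 / 2"
    using iexp_approx1[of "b * z" 1] by (simp add: e1_def power2_eq_square)
  have n2: "norm e2 \<le> \<bar>u * y\<bar> ^ 3 / 6"
    using iexp_approx1[of "u * y" 2]
    by (simp add: e2_def numeral_2_eq_2 numeral_3_eq_3 power2_eq_square field_simps)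
  have split: "iexp (u * y + b * z) - ?A =
      iexp (b * z) * e2 + \<i> * of_real (u * y) * e1 - of_real ((u * y)\<^sup>2 / 2) * e0"
  proof -
    have "E * F - (F + U - (- (U * B)) - H) = F * (E - (1 + U - H)) + U * (F - (1 + B)) - H * (F - 1)"
      for E F U B H :: complex
      by (simp add: algebra_simps)
    note this[of "iexp (u * y)" "iexp (b * z)" "\<i> * of_real (u * y)" "\<i> * of_real (b * z)"
        "of_real ((u * y)\<^sup>2 / 2)"]
    moreover have "iexp (u * y + b * z) = iexp (u * y) * iexp (b * z)"
      by (simp add: exp_add ring_distribs)
    moreover have "of_real (u * b * (y * z)) = - (\<i> * of_real (u * y) * (\<i> * complex_of_real (b * z)))"
      by (simp add: complex_eq_iff)
    moreover have "of_real (u\<^sup>2 / 2 * y\<^sup>2) = complex_of_real ((u * y)\<^sup>2 / 2)"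
      by (simp add: power_mult_distrib)
    ultimately show ?thesis
      unfolding e0_def e1_def e2_def by (simp only:)
  qed
  have "norm (iexp (u * y + b * z) - ?A)
      \<le> norm (iexp (b * z) * e2) + norm (\<i> * of_real (u * y) * e1) + norm (of_real ((u * y)\<^sup>2 / 2) * e0)"
    unfolding split by (meson norm_triangle_ineq norm_triangle_ineq4 order_trans add_mono order_refl)
  also have "\<dots> = norm e2 + \<bar>u * y\<bar> * norm e1 + (u * y)\<^sup>2 / 2 * norm e0"
    by (simp add: norm_mult del: of_real_mult of_real_power of_real_divide)
  also have "\<dots> \<le> \<bar>u * y\<bar> ^ 3 / 6 + \<bar>u * y\<bar> * ((b * z)\<^sup>2 / 2) + (u * y)\<^sup>2 / 2 * \<bar>b * z\<bar>"
    by (intro add_mono mult_left_mono n0 n1 n2) auto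
  also have "\<dots> = \<bar>u\<bar> ^ 3 / 6 * (\<bar>y\<bar> * \<bar>y\<bar> * \<bar>y\<bar>) + \<bar>u\<bar> * b\<^sup>2 / 2 * (\<bar>y\<bar> * z\<^sup>2 * 1)
      + u\<^sup>2 * \<bar>b\<bar> / 2 * (\<bar>y\<bar> * \<bar>y\<bar> * \<bar>z\<bar>)"
  proof -
    have "\<bar>u * y\<bar> ^ 3 / 6 = \<bar>u\<bar> ^ 3 / 6 * (\<bar>y\<bar> * \<bar>y\<bar> * \<bar>y\<bar>)"
      by (simp add: abs_mult power_mult_distrib power3_eq_cube del: abs_mult_self_eq)
    moreover have "\<bar>u * y\<bar> * ((b * z)\<^sup>2 / 2) = \<bar>u\<bar> * b\<^sup>2 / 2 * (\<bar>y\<bar> * z\<^sup>2 * 1)"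
      by (simp add: abs_mult power_mult_distrib)
    moreover have "(u * y)\<^sup>2 / 2 * \<bar>b * z\<bar> = u\<^sup>2 * \<bar>b\<bar> / 2 * (\<bar>y\<bar> * \<bar>y\<bar> * \<bar>z\<bar>)"
      by (simp add: abs_mult power_mult_distrib power2_eq_square)
    ultimately show ?thesis by simp
  qed
  also have "\<dots> \<le> \<bar>u\<bar> ^ 3 / 6 * (w * w * w) + \<bar>u\<bar> * b\<^sup>2 / 2 * (w * w * w) + u\<^sup>2 * \<bar>b\<bar> / 2 * (w * w * w)"
    using w1 by (intro add_mono mult_left_mono mult_mono yw zw z2w) auto
  also have "u\<^sup>2 * \<bar>b\<bar> \<le> (\<bar>u\<bar> ^ 3 + \<bar>u\<bar> * b\<^sup>2) / 2"
  proof -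
    have "0 \<le> \<bar>u\<bar> * (\<bar>u\<bar> - \<bar>b\<bar>)\<^sup>2" by simp
    also have "\<dots> = \<bar>u\<bar> ^ 3 + \<bar>u\<bar> * b\<^sup>2 - 2 * (u\<^sup>2 * \<bar>b\<bar>)"
      by (simp add: power2_diff power3_eq_cube algebra_simps power2_eq_square)
    finally show ?thesis by simp
  qed
  also have "\<bar>u\<bar> ^ 3 / 6 * (w * w * w) + \<bar>u\<bar> * b\<^sup>2 / 2 * (w * w * w)
        + (\<bar>u\<bar> ^ 3 + \<bar>u\<bar> * b\<^sup>2) / 2 / 2 * (w * w * w)
      = (\<bar>u\<bar> ^ 3 * (5/12) + \<bar>u\<bar> * b\<^sup>2 * (3/4)) * w ^ 3"
  proof -
    have "A / 6 * C + B / 2 * C + (A + B) / 2 / 2 * C = (A * (5/12) + B * (3/4)) * C" for A B C :: real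
      by (simp add: field_simps)
    then show ?thesis unfolding power3_eq_cube[of w] .
  qed
  also have "\<dots> \<le> (\<bar>u\<bar> ^ 3 + \<bar>u\<bar> * b\<^sup>2) * w ^ 3"
    using w1 by (intro mult_right_mono add_mono) (auto simp: mult_left_le)
  finally show ?thesis using w1 by (simp add: w_def mult_right_mono)
qed

lemma std_normal_moments:
  shows "has_bochner_integral std_normal_distribution (\<lambda>z. z) 0"
    and "has_bochner_integral std_normal_distribution (\<lambda>z. z ^ 2) 1"
    and "has_bochner_integral std_normal_distribution (\<lambda>z. z ^ 3) 0"
    and "has_bochner_integral std_normal_distribution (\<lambda>z. z ^ 4) 3"
    and "has_bochner_integral std_normal_distribution (\<lambda>z. z ^ 6) 15"
  using integrable_std_normal_distribution_moment[of 1] integral_std_normal_distribution_moment_odd[of 1]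
    integrable_std_normal_distribution_moment[of 2] std_normal_distribution_even_moments(1)[of 1]
    integrable_std_normal_distribution_moment[of 3] integral_std_normal_distribution_moment_odd[of 3]
    integrable_std_normal_distribution_moment[of 4] std_normal_distribution_even_moments(1)[of 2]
    integrable_std_normal_distribution_moment[of 6] std_normal_distribution_even_moments(1)[of 3]
  by (simp_all add: has_bochner_integral_iff fact_numeral)

lemma exp_minus_le_quadratic:
  fixes x :: real
  assumes "0 \<le> x"
  shows "exp (- x) \<le> 1 - x + x\<^sup>2 / 2"
proof -
  have "1 - 0 + 0\<^sup>2 / 2 - exp (- 0) \<le> 1 - x + x\<^sup>2 / 2 - exp (- x)"
  proof (rule DERIV_nonneg_imp_nondecreasing[OF assms], intro exI conjI)
    fix y :: real
    show "((\<lambda>x. 1 - x + x\<^sup>2 / 2 - exp (- x)) has_real_derivative (- 1 + y + exp (- y))) (at y)"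
      by (auto intro!: derivative_eq_intros)
    show "0 \<le> - 1 + y + exp (- y)"
      using exp_ge_add_one_self[of "- y"] by simp
  qed
  then show ?thesis by simp
qed

text \<open>
  Integrating the pointwise expansion gives \<open>exp (- b\<^sup>2 / 2) - u\<^sup>2\<close>: the first-order part vanishes
  because \<open>Z\<^sup>2 - 1\<close> is orthogonal to the constants and to \<open>Z\<close>. This agrees with the product
  \<open>exp (- u\<^sup>2) exp (- b\<^sup>2 / 2)\<close> up to errors of the same order when \<open>\<bar>u\<bar> \<le> 1\<close>, and for larger \<open>u\<close> the
  bound exceeds 2, the trivial one.
\<close>

lemma char_noncentral_square_approx:
  fixes u b :: real
  shows "norm ((CLINT z|std_normal_distribution. iexp (u * (z\<^sup>2 - 1) + b * z))
           - of_real (exp (- u\<^sup>2 - b\<^sup>2 / 2))) \<le> 29 * (\<bar>u\<bar> ^ 3 + \<bar>u\<bar> * b\<^sup>2)"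
    (is "norm (?\<phi> - of_real ?g) \<le> _")
proof -
  let ?N = std_normal_distribution
  interpret N: real_distribution ?N by (rule real_dist_normal_dist)
  let ?f = "\<lambda>z. iexp (u * (z\<^sup>2 - 1) + b * z)"
  let ?A = "\<lambda>z. iexp (b * z) + \<i> * of_real (u * (z\<^sup>2 - 1))
      - of_real (u * b * ((z\<^sup>2 - 1) * z)) - of_real (u\<^sup>2 / 2 * (z\<^sup>2 - 1)\<^sup>2)"
  let ?r = "\<bar>u\<bar> ^ 3 + \<bar>u\<bar> * b\<^sup>2"
  have one: "has_bochner_integral ?N (\<lambda>z. 1) (1::real)"
    using N.prob_space by (simp add: has_bochner_integral_iff)
  note mom = std_normal_moments
  have chi: "has_bochner_integral ?N (\<lambda>z. iexp (b * z)) (of_real (exp (- b\<^sup>2 / 2)))"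
    using N.integrable_iexp[of "\<lambda>z. b * z"] fun_cong[OF char_std_normal_distribution, of b]
    by (simp add: has_bochner_integral_iff char_def)
  have mY: "has_bochner_integral ?N (\<lambda>z. u * (z\<^sup>2 - 1)) 0"
    using has_bochner_integral_mult_right[of u, OF has_bochner_integral_diff[OF mom(2) one]] by simp
  have mYZ: "has_bochner_integral ?N (\<lambda>z. u * b * ((z\<^sup>2 - 1) * z)) 0"
    using has_bochner_integral_mult_right[of "u * b", OF has_bochner_integral_diff[OF mom(3) mom(1)]]
    by (simp add: power3_eq_cube power2_eq_square left_diff_distrib)
  have mYY: "has_bochner_integral ?N (\<lambda>z. u\<^sup>2 / 2 * (z\<^sup>2 - 1)\<^sup>2) (u\<^sup>2)"
  proof -
    have "has_bochner_integral ?N (\<lambda>z. u\<^sup>2 / 2 * (z ^ 4 - 2 * z ^ 2 + 1)) (u\<^sup>2 / 2 * (3 - 2 * 1 + 1))"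
      by (intro has_bochner_integral_mult_right has_bochner_integral_add has_bochner_integral_diff
          mom one)
    moreover have "(z\<^sup>2 - 1)\<^sup>2 = z ^ 4 - 2 * z ^ 2 + 1" for z :: real
      by (simp add: power2_diff)
    ultimately show ?thesis by simp
  qed
  have A: "has_bochner_integral ?N ?A (of_real (exp (- b\<^sup>2 / 2)) + \<i> * of_real 0 - of_real 0 - of_real (u\<^sup>2))"
    by (intro has_bochner_integral_add has_bochner_integral_diff chi
        has_bochner_integral_mult_right has_bochner_integral_of_real mY mYZ mYY)
  \<comment> \<open>The value 28 is the moment of \<open>(1 + Z\<^sup>2)\<^sup>3\<close>; the exponential form of the limit costs one more \<open>?r\<close>.\<close>
  have W: "has_bochner_integral ?N (\<lambda>z. ?r * (1 + z\<^sup>2) ^ 3) (?r * 28)"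
  proof -
    have "has_bochner_integral ?N (\<lambda>z. ?r * (1 + 3 * z ^ 2 + 3 * z ^ 4 + z ^ 6)) (?r * (1 + 3 * 1 + 3 * 3 + 15))"
      by (intro has_bochner_integral_mult_right has_bochner_integral_add mom one)
    moreover have "(1 + z\<^sup>2) ^ 3 = 1 + 3 * z ^ 2 + 3 * z ^ 4 + z ^ 6" for z :: real
      by (simp add: eval_nat_numeral algebra_simps)
    ultimately show ?thesis by simp
  qed
  have f: "integrable ?N ?f" by (rule N.integrable_iexp) auto
  have "norm (?\<phi> - (of_real (exp (- b\<^sup>2 / 2)) - of_real (u\<^sup>2))) = norm (CLINT z|?N. ?f z - ?A z)"
    using f A by (simp add: has_bochner_integral_iff)
  also have "\<dots> \<le> (LINT z|?N. ?r * (1 + z\<^sup>2) ^ 3)"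
  proof (rule Bochner_Integration.integral_norm_bound_integral)
    show "integrable ?N (\<lambda>z. ?f z - ?A z)"
      using A by (intro Bochner_Integration.integrable_diff[OF f]) (simp add: has_bochner_integral_iff)
    show "integrable ?N (\<lambda>z. ?r * (1 + z\<^sup>2) ^ 3)"
      using W by (simp add: has_bochner_integral_iff)
  qed (rule norm_iexp_quadratic_expansion_le)
  also have "\<dots> = 28 * ?r" using W by (simp add: has_bochner_integral_iff)
  finally have main: "norm (?\<phi> - of_real (exp (- b\<^sup>2 / 2) - u\<^sup>2)) \<le> 28 * ?r"
    by simp
  show ?thesis
  proof (cases "\<bar>u\<bar> \<le> 1")
    case True
    define p where "p = exp (- b\<^sup>2 / 2)"
    have p: "0 \<le> p" "p \<le> 1" "1 - p \<le> b\<^sup>2 / 2"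
      using exp_ge_add_one_self[of "- b\<^sup>2 / 2"] by (auto simp: p_def)
    have q: "0 \<le> exp (- u\<^sup>2) - 1 + u\<^sup>2" "exp (- u\<^sup>2) - 1 + u\<^sup>2 \<le> (u\<^sup>2)\<^sup>2 / 2"
    proof -
      show "0 \<le> exp (- u\<^sup>2) - 1 + u\<^sup>2" using exp_ge_add_one_self[of "- u\<^sup>2"] by simp
      from exp_minus_le_quadratic[of "u\<^sup>2"] show "exp (- u\<^sup>2) - 1 + u\<^sup>2 \<le> (u\<^sup>2)\<^sup>2 / 2" by simp
    qed
    have g: "?g = p * exp (- u\<^sup>2)" by (simp add: p_def exp_add[symmetric])
    have eq: "p - u\<^sup>2 - ?g = - (u\<^sup>2 * (1 - p)) - p * (exp (- u\<^sup>2) - 1 + u\<^sup>2)"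
      unfolding g by (simp add: algebra_simps)
    have "\<bar>p - u\<^sup>2 - ?g\<bar> \<le> u\<^sup>2 * (1 - p) + p * (exp (- u\<^sup>2) - 1 + u\<^sup>2)"
      unfolding eq using p q(1) mult_nonneg_nonneg[OF p(1) q(1)] by (simp add: abs_if)
    also have "\<dots> \<le> u\<^sup>2 * (b\<^sup>2 / 2) + 1 * ((u\<^sup>2)\<^sup>2 / 2)"
      using p q by (intro add_mono mult_mono) auto
    also have "\<dots> = \<bar>u\<bar> * (\<bar>u\<bar> ^ 3 + \<bar>u\<bar> * b\<^sup>2) / 2"
      by (simp add: eval_nat_numeral field_simps)
    also have "\<dots> \<le> 1 * ?r / 2"
      using True by (intro divide_right_mono mult_right_mono) auto
    also have "\<dots> \<le> ?r" by simp
    finally have "norm (of_real (p - u\<^sup>2) - of_real ?g :: complex) \<le> ?r"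
      by (metis norm_of_real of_real_diff)
    with main show ?thesis
      using norm_triangle_ineq[of "?\<phi> - of_real (p - u\<^sup>2)" "of_real (p - u\<^sup>2) - of_real ?g"]
      by (simp add: p_def)
  next
    case False
    have "norm ?\<phi> \<le> (LINT z|?N. 1)"
      by (rule Bochner_Integration.integral_norm_bound_integral[OF f]) auto
    then have "norm ?\<phi> \<le> 1" using N.prob_space by simp
    moreover have "- u\<^sup>2 - b\<^sup>2 / 2 \<le> 0"
      using zero_le_power2[of u] zero_le_power2[of b] by linarith
    then have "?g \<le> 1" by simp
    ultimately have "norm (?\<phi> - of_real ?g) \<le> 1 + 1"
      by (intro order_trans[OF norm_triangle_ineq4] add_mono) auto
    also have "\<dots> \<le> 29 * \<bar>u\<bar> ^ 3"
    proof -
      have "1 \<le> \<bar>u\<bar> ^ 3" using False by (intro one_le_power) simp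
      then show ?thesis by simp
    qed
    also have "\<dots> \<le> 29 * ?r" by simp
    finally show ?thesis .
  qed
qed

section \<open>Uniform convergence of distribution functions\<close>

text \<open>
  This is Polya's theorem. By continuity the limit takes each value \<open>j / N\<close> with \<open>0 < j < N\<close> at some
  point. Both sides are monotone, so closeness at these finitely many points traps the difference
  everywhere, up to the increment \<open>1 / N\<close> of the limit between two of them.
\<close>

lemma weak_conv_m_imp_uniform_limit_cdf:
  fixes M :: "nat \<Rightarrow> real measure" and M' :: "real measure"
  assumes M: "\<And>n. real_distribution (M n)" and M': "real_distribution M'"
    and conv: "weak_conv_m M M'" and cont: "\<And>x. isCont (cdf M') x"
  shows "uniform_limit UNIV (\<lambda>n. cdf (M n)) (cdf M') sequentially"
proof (rule uniform_limitI)
  fix e :: real assume e: "0 < e"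
  interpret Mn: real_distribution "M n" for n by fact
  interpret M': real_distribution M' by fact
  let ?F = "cdf M'"
  obtain N :: nat where N: "N > 0" "2 / N < e"
    using reals_Archimedean2[of "2 / e"] e
    by (metis divide_less_eq gr0I less_divide_eq less_irrefl mult.commute of_nat_0 of_nat_0_less_iff
        divide_pos_pos order_less_trans zero_less_numeral)
  have quantile: "\<exists>q. ?F q = p" if p: "0 < p" "p < 1" for p
  proof -
    obtain a where a: "?F a < p"
      using order_tendstoD(2)[OF M'.cdf_lim_at_bot p(1)] by (auto simp: eventually_at_bot_linorder)
    obtain b where b: "p < ?F b"
      using order_tendstoD(1)[OF M'.cdf_lim_at_top_prob p(2)] by (auto simp: eventually_at_top_linorder)
    have "a \<le> b" using a b M'.cdf_nondecreasing[of b a] by linarith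
    then show ?thesis using IVT[of ?F a p b] a b cont by auto
  qed
  then obtain q where q: "?F (q j) = real j / N" if "j \<in> {1..<N}" for j
    using bchoice[of "{1..<N}" "\<lambda>j x. ?F x = real j / N"] by force
  have "\<forall>\<^sub>F n in sequentially. \<forall>j\<in>{1..<N}. dist (cdf (M n) (q j)) (?F (q j)) < 1 / N"
    using conv cont N by (intro eventually_ball_finite ballI tendstoD)
      (auto simp: weak_conv_m_def weak_conv_def)
  then show "\<forall>\<^sub>F n in sequentially. \<forall>x\<in>UNIV. dist (cdf (M n) x) (?F x) < e"
  proof eventually_elim
    case (elim n)
    have near: "\<bar>cdf (M n) (q j) - real j / N\<bar> < 1 / N" if "j \<in> {1..<N}" for j
      using elim that q by (auto simp: dist_real_def)
    show ?case
    proof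
      fix x
      have F01: "0 \<le> ?F x" "?F x \<le> 1" by (auto simp: M'.cdf_nonneg M'.cdf_bounded_prob)
      have G01: "0 \<le> cdf (M n) x" "cdf (M n) x \<le> 1" by (auto simp: Mn.cdf_nonneg Mn.cdf_bounded_prob)
      have upper: "cdf (M n) x \<le> ?F x + 2 / N"
      proof -
        \<comment> \<open>The least grid value strictly above \<open>?F x\<close>; strictness is what puts its quantile to the right of \<open>x\<close>.\<close>
        define j where "j = nat (\<lfloor>N * ?F x\<rfloor> + 1)"
        have j: "N * ?F x < j" "j \<le> N * ?F x + 1" "j \<ge> 1"
        proof -
          have "0 \<le> \<lfloor>N * ?F x\<rfloor>" using F01 by simp
          then have "real j = of_int \<lfloor>N * ?F x\<rfloor> + 1" "j \<ge> 1" by (auto simp: j_def le_nat_iff)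
          then show "N * ?F x < j" "j \<le> N * ?F x + 1" "j \<ge> 1"
            using floor_correct[of "N * ?F x"] by linarith+
        qed
        show ?thesis
        proof (cases "j < N")
          case True
          with j N have jN: "j \<in> {1..<N}" and F: "?F x < real j / N" "real j / N \<le> ?F x + 1 / N"
            by (auto simp: field_simps)
          have "x \<le> q j"
            using F(1) q[OF jN] M'.cdf_nondecreasing[of "q j" x] by linarith
          then have "cdf (M n) x \<le> cdf (M n) (q j)" by (rule Mn.cdf_nondecreasing)
          with near[OF jN] F(2) show ?thesis by (simp add: abs_less_iff)
        next
          case False
          with j N have "1 \<le> ?F x + 1 / N" by (simp add: field_simps)
          moreover have "1 / N \<le> 2 / real N" by (simp add: divide_right_mono)
          ultimately show ?thesis using G01 by linarith
        qed
      qed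
      have lower: "?F x - 2 / N \<le> cdf (M n) x"
      proof (cases "N * ?F x \<le> 1")
        case True
        then have "?F x \<le> 1 / N" using N by (simp add: field_simps)
        moreover have "1 / N \<le> 2 / real N" by (simp add: divide_right_mono)
        ultimately show ?thesis using G01 by linarith
      next
        case False
        \<comment> \<open>The greatest grid value strictly below \<open>?F x\<close>.\<close>
        define j where "j = nat (\<lceil>N * ?F x\<rceil> - 1)"
        have j: "j < N * ?F x" "N * ?F x \<le> j + 1" "j \<ge> 1"
        proof -
          have "2 \<le> \<lceil>N * ?F x\<rceil>" using False by linarith
          then have "real j = of_int \<lceil>N * ?F x\<rceil> - 1" "j \<ge> 1" by (auto simp: j_def le_nat_iff)
          then show "j < N * ?F x" "N * ?F x \<le> j + 1" "j \<ge> 1"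
            using ceiling_correct[of "N * ?F x"] by linarith+
        qed
        moreover have "N * ?F x \<le> N" using F01 by (simp add: mult_left_le)
        ultimately have jN: "j \<in> {1..<N}" by auto
        have F: "real j / N < ?F x" "?F x \<le> real j / N + 1 / N"
          using j N by (auto simp: field_simps)
        have "q j \<le> x"
          using F(1) q[OF jN] M'.cdf_nondecreasing[of x "q j"] by linarith
        then have "cdf (M n) (q j) \<le> cdf (M n) x" by (rule Mn.cdf_nondecreasing)
        with near[OF jN] F(2) show ?thesis by (simp add: abs_less_iff)
      qed
      from upper lower N(2) show "dist (cdf (M n) x) (?F x) < e"
        by (simp add: dist_real_def abs_less_iff)
    qed
  qed
qed

lemma isCont_cdf_std_normal: "isCont (cdf std_normal_distribution) x"
proof -
  interpret real_distribution std_normal_distribution by (rule real_dist_normal_dist)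
  have "emeasure std_normal_distribution {x} = 0"
    by (simp add: emeasure_density)
  then show ?thesis by (simp add: isCont_cdf measure_def)
qed


section \<open>A central limit theorem uniform in the linear coefficients\<close>

text \<open>
  A product of numbers in the unit disc is 1-Lipschitz in each factor, so the errors of the
  individual characteristic functions add up. The Gaussian factors multiply to exactly
  \<open>exp (- t\<^sup>2 / 2)\<close> by the choice of \<open>\<tau>\<close>. The bound does not mention \<open>a\<close>, which is what gives the
  uniformity in \<open>\<theta>\<close> and in the initial estimator.
\<close>

lemma (in prob_space) char_quadratic_form_approx:
  fixes Z :: "nat \<Rightarrow> 'a \<Rightarrow> real" and a :: "nat \<Rightarrow> real" and k :: nat and t :: real
  assumes indep: "indep_vars (\<lambda>_. borel) Z UNIV"
    and distr: "\<And>i. distributed M lborel (Z i) std_normal_density"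
    and k: "0 < k"
  defines "\<tau> \<equiv> sqrt (2 * real k + 4 * (\<Sum>i<k. (a i)\<^sup>2))"
  shows "norm (char (distr M borel (\<lambda>\<omega>. (\<Sum>i<k. (Z i \<omega>)\<^sup>2 - 1 + 2 * a i * Z i \<omega>) / \<tau>)) t
           - of_real (exp (- t\<^sup>2 / 2))) \<le> 29 * \<bar>t\<bar> ^ 3 / sqrt (2 * real k)"
proof -
  define Q where "Q = 2 * real k + 4 * (\<Sum>i<k. (a i)\<^sup>2)"
  have Qk: "2 * real k \<le> Q" by (simp add: Q_def sum_nonneg)
  have \<tau>: "\<tau> > 0" "\<tau>\<^sup>2 = Q" "sqrt (2 * real k) \<le> \<tau>"
    using Qk k by (auto simp: \<tau>_def Q_def[symmetric])
  define u where "u = t / \<tau>"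
  define f where "f i z = (z\<^sup>2 - 1 + 2 * a i * z) / \<tau>" for i and z :: real
  have [measurable]: "f i \<in> borel_measurable borel" for i unfolding f_def by measurable
  have Z[measurable]: "Z i \<in> borel_measurable M" for i
    using distributed_measurable[OF distr] by simp
  define \<phi> where "\<phi> i = char (distr M borel (\<lambda>\<omega>. f i (Z i \<omega>))) t" for i
  define g where "g i = exp (- u\<^sup>2 - (2 * u * a i)\<^sup>2 / 2)" for i
  have "char (distr M borel (\<lambda>\<omega>. \<Sum>i<k. f i (Z i \<omega>))) t = (\<Prod>i<k. \<phi> i)"
    unfolding \<phi>_def
    by (rule char_distr_sum, rule indep_vars_subset[OF indep_vars_compose2[OF indep]]) auto
  then have char_eq: "char (distr M borel (\<lambda>\<omega>. (\<Sum>i<k. (Z i \<omega>)\<^sup>2 - 1 + 2 * a i * Z i \<omega>) / \<tau>)) t = (\<Prod>i<k. \<phi> i)"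
    by (simp add: f_def sum_divide_distrib)
  have exp_eq: "exp (- t\<^sup>2 / 2) = (\<Prod>i<k. g i)"
  proof -
    have "(\<Sum>i<k. - u\<^sup>2 - (2 * u * a i)\<^sup>2 / 2) = - u\<^sup>2 * Q / 2"
      by (simp add: sum_subtractf sum_negf Q_def power_mult_distrib sum_distrib_left algebra_simps)
    also have "\<dots> = - t\<^sup>2 / 2"
      using \<tau>(2) Qk k by (simp add: u_def power_divide)
    finally show ?thesis by (simp add: g_def exp_sum[symmetric])
  qed
  have \<phi>_approx: "norm (\<phi> i - of_real (g i)) \<le> 29 * (\<bar>u\<bar> ^ 3 + \<bar>u\<bar> * (2 * u * a i)\<^sup>2)" for i
  proof -
    have "\<phi> i = (CLINT \<omega>|M. iexp (t * f i (Z i \<omega>)))"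
      unfolding \<phi>_def char_def by (subst integral_distr) auto
    also have "\<dots> = (CLINT z|distr M lborel (Z i). iexp (t * f i z))"
      by (subst integral_distr) auto
    also have "distr M lborel (Z i) = std_normal_distribution"
      using distributed_distr_eq_density[OF distr] .
    also have "(CLINT z|std_normal_distribution. iexp (t * f i z))
        = (CLINT z|std_normal_distribution. iexp (u * (z\<^sup>2 - 1) + (2 * u * a i) * z))"
      by (intro Bochner_Integration.integral_cong refl arg_cong[where f = iexp])
         (simp add: f_def u_def add_divide_distrib diff_divide_distrib algebra_simps)
    finally show ?thesis
      using char_noncentral_square_approx[of u "2 * u * a i"] by (simp add: g_def)
  qed
  have "norm ((\<Prod>i<k. \<phi> i) - (\<Prod>i<k. of_real (g i))) \<le> (\<Sum>i<k. norm (\<phi> i - of_real (g i)))"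
  proof (rule norm_prod_diff)
    show "norm (\<phi> i) \<le> 1" for i
      unfolding \<phi>_def by (rule real_distribution.cmod_char_le_1) (auto intro!: real_distribution_distr)
    show "norm (of_real (g i) :: complex) \<le> 1" for i
    proof -
      have "- u\<^sup>2 - (2 * u * a i)\<^sup>2 / 2 \<le> 0"
        using zero_le_power2[of u] zero_le_power2[of "2 * u * a i"] by linarith
      then show ?thesis unfolding g_def norm_of_real by simp
    qed
  qed
  also have "\<dots> \<le> (\<Sum>i<k. 29 * (\<bar>u\<bar> ^ 3 + \<bar>u\<bar> * (2 * u * a i)\<^sup>2))"
    by (intro sum_mono \<phi>_approx)
  also have "\<dots> = 29 * \<bar>u\<bar> ^ 3 * (real k + 4 * (\<Sum>i<k. (a i)\<^sup>2))"
    by (simp add: sum.distrib sum_distrib_left power3_eq_cube power2_eq_square algebra_simps)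
  also have "\<dots> \<le> 29 * \<bar>u\<bar> ^ 3 * Q"
    by (intro mult_left_mono) (auto simp: Q_def)
  also have "\<dots> = 29 * \<bar>t\<bar> ^ 3 / \<tau>"
    using \<tau>(1) unfolding \<tau>(2)[symmetric] u_def
    by (simp add: abs_divide power_divide power3_eq_cube power2_eq_square)
  also have "\<dots> \<le> 29 * \<bar>t\<bar> ^ 3 / sqrt (2 * real k)"
    using \<tau> k by (intro divide_left_mono) auto
  finally show ?thesis unfolding char_eq exp_eq by simp
qed

text \<open>
  The probability space may change with \<open>n\<close>, so that the parameter \<open>\<theta>\<close> may be chosen anew for
  every \<open>n\<close>.
\<close>

lemma weak_conv_m_normalized_quadratic_form:
  fixes M :: "nat \<Rightarrow> 'w measure" and Z :: "nat \<Rightarrow> nat \<Rightarrow> 'w \<Rightarrow> real"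
    and a :: "nat \<Rightarrow> nat \<Rightarrow> real" and k :: "nat \<Rightarrow> nat"
  assumes M: "\<And>n. prob_space (M n)"
    and indep: "\<And>n. prob_space.indep_vars (M n) (\<lambda>_. borel) (Z n) UNIV"
    and distr: "\<And>n i. distributed (M n) lborel (Z n i) std_normal_density"
    and k: "\<And>n. 0 < k n" "filterlim k at_top sequentially"
  shows "weak_conv_m (\<lambda>n. distr (M n) borel (\<lambda>\<omega>.
           (\<Sum>i<k n. (Z n i \<omega>)\<^sup>2 - 1 + 2 * a n i * Z n i \<omega>) / sqrt (2 * real (k n) + 4 * (\<Sum>i<k n. (a n i)\<^sup>2))))
         std_normal_distribution"
    (is "weak_conv_m (\<lambda>n. distr (M n) borel (?W n)) _")
proof (rule levy_continuity)
  have Z[measurable]: "Z n i \<in> borel_measurable (M n)" for n i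
    using distributed_measurable[OF distr] by simp
  show "real_distribution (distr (M n) borel (?W n))" for n
    by (rule prob_space.real_distribution_distr[OF M]) measurable
  show "real_distribution std_normal_distribution" by (rule real_dist_normal_dist)
  fix t
  have bound: "norm (char (distr (M n) borel (?W n)) t - char std_normal_distribution t)
      \<le> 29 * \<bar>t\<bar> ^ 3 / sqrt (2 * real (k n))" for n
    using prob_space.char_quadratic_form_approx[OF M indep distr k(1)]
    by (simp add: char_std_normal_distribution)
  have "(\<lambda>n. 29 * \<bar>t\<bar> ^ 3 / sqrt (2 * real (k n))) \<longlonglongrightarrow> 0"
    by (rule real_tendsto_divide_at_top[OF tendsto_const filterlim_compose[OF sqrt_at_top
          filterlim_tendsto_pos_mult_at_top[OF tendsto_const _
            filterlim_compose[OF filterlim_real_sequentially k(2)]]]]) simp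
  then have "(\<lambda>n. char (distr (M n) borel (?W n)) t - char std_normal_distribution t) \<longlonglongrightarrow> 0"
    by (rule Lim_null_comparison[rotated]) (use bound in simp)
  then show "(\<lambda>n. char (distr (M n) borel (?W n)) t) \<longlonglongrightarrow> char std_normal_distribution t"
    by (rule LIM_zero_cancel)
qed

section \<open>Uniformity over the parameter\<close>

text \<open>
  For each \<open>n\<close> choose a point whose value comes within \<open>1 / (n + 1)\<close> of the supremum; the
  assumption applies to the sequence of these points.
\<close>

lemma tendsto_SUP_zeroI:
  fixes g :: "nat \<Rightarrow> 'b \<Rightarrow> real"
  assumes A: "A \<noteq> {}" and nonneg: "\<And>n x. x \<in> A \<Longrightarrow> 0 \<le> g n x"
    and bdd: "\<And>n. bdd_above (g n ` A)"
    and along: "\<And>x. (\<And>n. x n \<in> A) \<Longrightarrow> (\<lambda>n. g n (x n)) \<longlonglongrightarrow> 0"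
  shows "(\<lambda>n. SUP x\<in>A. g n x) \<longlonglongrightarrow> 0"
proof -
  have "\<exists>x\<in>A. (SUP x\<in>A. g n x) - 1 / real (Suc n) < g n x" for n
  proof -
    have "(SUP x\<in>A. g n x) - 1 / real (Suc n) < (SUP x\<in>A. g n x)" by simp
    then show ?thesis by (simp only: less_cSUP_iff[OF A bdd])
  qed
  then obtain x where x: "\<And>n. x n \<in> A"
      "\<And>n. (SUP x\<in>A. g n x) - 1 / real (Suc n) < g n (x n)"
    by metis
  have "(\<lambda>n. g n (x n) + 1 / real (Suc n)) \<longlonglongrightarrow> 0 + 0"
    by (intro tendsto_add along x lim_inverse_n'[THEN LIMSEQ_Suc])
  then have upper: "(\<lambda>n. g n (x n) + 1 / real (Suc n)) \<longlonglongrightarrow> 0" by simp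
  have "0 \<le> (SUP x\<in>A. g n x)" for n
    using A nonneg by (auto intro: cSUP_upper2[OF bdd])
  moreover have "(SUP x\<in>A. g n x) \<le> g n (x n) + 1 / real (Suc n)" for n
    using x(2)[of n] by linarith
  ultimately show ?thesis
    by (intro tendsto_sandwich[OF always_eventually always_eventually tendsto_const upper] allI)
qed

text \<open>
  Expanding \<open>(x\<^sub>i - t\<^sub>i)\<^sup>2\<close> around \<open>\<theta>\<^sub>i\<close> cancels the squared bias, and measuring everything in units of
  the noise level \<open>s\<close> cancels a factor \<open>s\<^sup>2\<close> in numerator and denominator.
\<close>

lemma normalized_risk_error_eq:
  fixes \<sigma> :: real and \<theta> t x :: "nat \<Rightarrow> real" and k n :: nat
  assumes "\<sigma> > 0" and "n \<ge> 1"
  defines "s \<equiv> sqrt (\<sigma>\<^sup>2 / real n)"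
  shows "(risk_stat \<sigma> k n x t - (\<Sum>i<k. (\<theta> i - t i)\<^sup>2)) / tau_hat \<sigma> k n \<theta> t
       = (\<Sum>i<k. ((x i - \<theta> i) / s)\<^sup>2 - 1 + 2 * ((\<theta> i - t i) / s) * ((x i - \<theta> i) / s))
         / sqrt (2 * real k + 4 * (\<Sum>i<k. ((\<theta> i - t i) / s)\<^sup>2))"
proof -
  have s: "s > 0" "s\<^sup>2 = \<sigma>\<^sup>2 / real n" using assms by (auto simp: s_def)
  define c where "c = (\<Sum>i<k. ((\<theta> i - t i) / s)\<^sup>2)"
  have c: "(\<Sum>i<k. (\<theta> i - t i)\<^sup>2) = s\<^sup>2 * c"
    using s(1) by (simp add: c_def sum_distrib_left power_divide)
  have "2 * real k * \<sigma> ^ 4 / (real n)\<^sup>2 + 4 * \<sigma>\<^sup>2 / real n * (\<Sum>i<k. (\<theta> i - t i)\<^sup>2)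
      = 2 * real k * (\<sigma>\<^sup>2 / real n)\<^sup>2 + 4 * (\<sigma>\<^sup>2 / real n) * (s\<^sup>2 * c)"
    unfolding c by (simp add: power_divide)
  also have "\<dots> = (s\<^sup>2)\<^sup>2 * (2 * real k + 4 * c)"
    unfolding s(2)[symmetric] by (simp add: power2_eq_square algebra_simps)
  finally have "tau_hat \<sigma> k n \<theta> t = sqrt ((s\<^sup>2)\<^sup>2 * (2 * real k + 4 * c))"
    unfolding tau_hat_def by (rule arg_cong)
  then have tau: "tau_hat \<sigma> k n \<theta> t = s\<^sup>2 * sqrt (2 * real k + 4 * (\<Sum>i<k. ((\<theta> i - t i) / s)\<^sup>2))"
    by (simp only: real_sqrt_mult real_sqrt_abs abs_power2 c_def)
  have term_eq: "(x i - t i)\<^sup>2 - s\<^sup>2 - (\<theta> i - t i)\<^sup>2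
      = s\<^sup>2 * (((x i - \<theta> i) / s)\<^sup>2 - 1 + 2 * ((\<theta> i - t i) / s) * ((x i - \<theta> i) / s))" for i
    using s(1) by (simp add: field_simps power2_eq_square)
  have "risk_stat \<sigma> k n x t - (\<Sum>i<k. (\<theta> i - t i)\<^sup>2) = (\<Sum>i<k. (x i - t i)\<^sup>2 - s\<^sup>2 - (\<theta> i - t i)\<^sup>2)"
    by (simp add: risk_stat_def sum_subtractf s(2))
  also have "\<dots> = s\<^sup>2 * (\<Sum>i<k. ((x i - \<theta> i) / s)\<^sup>2 - 1 + 2 * ((\<theta> i - t i) / s) * ((x i - \<theta> i) / s))"
    unfolding term_eq by (rule sum_distrib_left[symmetric])
  finally show ?thesis using s(1) by (simp add: tau)
qed

theorem theorem3p1: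
  fixes \<sigma> :: real
    and S :: "'w measure"
    and P :: "(nat \<Rightarrow> real) \<Rightarrow> 'w measure"
    and X :: "nat \<Rightarrow> 'w \<Rightarrow> nat \<Rightarrow> real"
    and \<theta>hat :: "nat \<Rightarrow> 'w \<Rightarrow> nat \<Rightarrow> real"
    and k :: "nat \<Rightarrow> nat"
  assumes "\<sigma> > 0"
    and "\<And>\<theta>. \<theta> \<in> ell2 \<Longrightarrow> prob_space (P \<theta>)"
    and "\<And>\<theta>. \<theta> \<in> ell2 \<Longrightarrow> sets (P \<theta>) = sets S"
    and "\<And>\<theta> n. \<theta> \<in> ell2 \<Longrightarrow> n \<ge> 1 \<Longrightarrow>
           prob_space.indep_vars (P \<theta>) (\<lambda>_. borel) (\<lambda>i \<omega>. X n \<omega> i) UNIV"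
    and "\<And>\<theta> n i. \<theta> \<in> ell2 \<Longrightarrow> n \<ge> 1 \<Longrightarrow>
           distributed (P \<theta>) lborel (\<lambda>\<omega>. X n \<omega> i) (normal_density (\<theta> i) (sqrt (\<sigma>\<^sup>2 / real n)))"
    and "\<And>n. n \<ge> 1 \<Longrightarrow> \<theta>hat n \<in> S \<rightarrow>\<^sub>M ell2_borel"
    and "\<And>\<theta> n. \<theta> \<in> ell2 \<Longrightarrow> n \<ge> 1 \<Longrightarrow>
           prob_space.indep_var (P \<theta>) ell2_borel (\<theta>hat n) (Pi\<^sub>M UNIV (\<lambda>_. borel)) (X n)"
    and "\<And>n. n \<ge> 1 \<Longrightarrow> k n > 0"
    and "filterlim k at_top sequentially"
  shows "\<forall>\<theta>\<^sub>0\<in>ell2. AE \<omega> in P \<theta>\<^sub>0.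
           (\<lambda>n. SUP \<theta>\<in>ell2. SUP x.
              \<bar>cond_prob_given (P \<theta>) (X n) (\<theta>hat n)
                 (\<lambda>y t. (risk_stat \<sigma> (k n) n y t - (\<Sum>i<k n. (\<theta> i - t i)\<^sup>2))
                          / tau_hat \<sigma> (k n) n \<theta> t \<le> x) \<omega>
               - cdf std_normal_distribution x\<bar>) \<longlonglongrightarrow> 0"
proof (intro ballI AE_I2)
  fix \<theta>\<^sub>0 \<omega>
  let ?\<Phi> = "cdf std_normal_distribution"
  let ?Q = "\<lambda>n \<theta> x y t. (risk_stat \<sigma> (k n) n y t - (\<Sum>i<k n. (\<theta> i - t i)\<^sup>2))
                          / tau_hat \<sigma> (k n) n \<theta> t \<le> x"
  let ?d = "\<lambda>n \<theta> x. \<bar>cond_prob_given (P \<theta>) (X n) (\<theta>hat n) (?Q n \<theta> x) \<omega> - ?\<Phi> x\<bar>"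
  interpret \<Phi>: real_distribution std_normal_distribution by (rule real_dist_normal_dist)
  have d_le_1: "?d n \<theta> x \<le> 1" if "\<theta> \<in> ell2" for n \<theta> x
  proof -
    interpret prob_space "P \<theta>" using assms(2) that .
    show ?thesis
      using \<Phi>.cdf_nonneg[of x] \<Phi>.cdf_bounded_prob[of x]
        measure_nonneg[of "P \<theta>"] prob_le_1
      unfolding cond_prob_given_def abs_le_iff by (smt (verit))
  qed
  have bdd_x: "bdd_above (range (?d n \<theta>))" if "\<theta> \<in> ell2" for n \<theta>
    using d_le_1[OF that] by (intro bdd_aboveI[of _ 1]) auto
  have sup_nonneg: "0 \<le> (SUP x. ?d n \<theta> x)" if "\<theta> \<in> ell2" for n \<theta>
    by (rule cSUP_upper2[OF bdd_x[OF that], of 0]) auto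
  have sup_le_1: "(SUP x. ?d n \<theta> x) \<le> 1" if "\<theta> \<in> ell2" for n \<theta>
    using d_le_1[OF that] by (intro cSUP_least) auto
  \<comment> \<open>The index is shifted because the model is only specified for \<open>n \<ge> 1\<close>.\<close>
  have "(\<lambda>n. SUP \<theta>\<in>ell2. SUP x. ?d (Suc n) \<theta> x) \<longlonglongrightarrow> 0"
  proof (rule tendsto_SUP_zeroI)
    have "(\<lambda>_. 0) \<in> ell2" by (simp add: ell2_def)
    then show "ell2 \<noteq> {}" by blast
    show "0 \<le> (SUP x. ?d (Suc n) \<theta> x)" if "\<theta> \<in> ell2" for n \<theta> using sup_nonneg that .
    show "bdd_above ((\<lambda>\<theta>. SUP x. ?d (Suc n) \<theta> x) ` ell2)" for n
      using sup_le_1 by (intro bdd_aboveI[of _ 1]) auto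
    fix \<theta> :: "nat \<Rightarrow> nat \<Rightarrow> real" assume \<theta>: "\<And>n. \<theta> n \<in> ell2"
    define s where "s n = sqrt (\<sigma>\<^sup>2 / real (Suc n))" for n
    define Z where "Z n i \<omega>' = (X (Suc n) \<omega>' i - \<theta> n i) / s n" for n i \<omega>'
    define a where "a n i = (\<theta> n i - \<theta>hat (Suc n) \<omega> i) / s n" for n i
    define W where "W n \<omega>' = (\<Sum>i<k (Suc n). (Z n i \<omega>')\<^sup>2 - 1 + 2 * a n i * Z n i \<omega>')
        / sqrt (2 * real (k (Suc n)) + 4 * (\<Sum>i<k (Suc n). (a n i)\<^sup>2))" for n \<omega>'
    define L where "L n = distr (P (\<theta> n)) borel (W n)" for n
    have s_pos: "s n > 0" for n using assms(1) by (simp add: s_def)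
    have distr: "distributed (P (\<theta> n)) lborel (Z n i) std_normal_density" for n i
      using assms(5)[OF \<theta>, of "Suc n" n i] s_pos[of n]
        prob_space.normal_standard_normal_convert[OF assms(2)[OF \<theta>], of "s n" n "\<lambda>\<omega>. X (Suc n) \<omega> i"]
      by (simp add: s_def Z_def[abs_def])
    have indep: "prob_space.indep_vars (P (\<theta> n)) (\<lambda>_. borel) (Z n) UNIV" for n
      unfolding Z_def[abs_def]
      by (rule prob_space.indep_vars_compose2[OF assms(2)[OF \<theta>] assms(4)[OF \<theta>]]) auto
    have [measurable]: "Z n i \<in> borel_measurable (P (\<theta> n))" for n i
      using distributed_measurable[OF distr] by simp
    have W_meas[measurable]: "W n \<in> borel_measurable (P (\<theta> n))" for n
      unfolding W_def by measurable
    have L: "real_distribution (L n)" for n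
      unfolding L_def by (rule prob_space.real_distribution_distr[OF assms(2)[OF \<theta>] W_meas])
    have "weak_conv_m L std_normal_distribution"
      unfolding L_def[abs_def] W_def[abs_def]
      using assms(2,8,9) \<theta> indep distr
      by (intro weak_conv_m_normalized_quadratic_form) (auto simp: filterlim_sequentially_Suc)
    then have unif: "uniform_limit UNIV (\<lambda>n. cdf (L n)) ?\<Phi> sequentially"
      using L real_dist_normal_dist isCont_cdf_std_normal by (intro weak_conv_m_imp_uniform_limit_cdf)
    have cond_eq: "cond_prob_given (P (\<theta> n)) (X (Suc n)) (\<theta>hat (Suc n)) (?Q (Suc n) (\<theta> n) x) \<omega> = cdf (L n) x"
      for n x
    proof -
      have "cdf (L n) x = measure (P (\<theta> n)) (W n -` {..x} \<inter> space (P (\<theta> n)))"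
        unfolding cdf_def L_def by (rule measure_distr) auto
      also have "W n -` {..x} \<inter> space (P (\<theta> n))
          = {\<omega>' \<in> space (P (\<theta> n)). ?Q (Suc n) (\<theta> n) x (X (Suc n) \<omega>') (\<theta>hat (Suc n) \<omega>)}"
        using normalized_risk_error_eq[OF assms(1), of "Suc n"]
        by (auto simp: W_def Z_def a_def s_def)
      finally show ?thesis by (simp add: cond_prob_given_def)
    qed
    show "(\<lambda>n. SUP x. ?d (Suc n) (\<theta> n) x) \<longlonglongrightarrow> 0"
    proof (rule LIMSEQ_I)
      fix e :: real assume e: "0 < e"
      then obtain N where N: "\<bar>cdf (L n) x - ?\<Phi> x\<bar> < e / 2" if "n \<ge> N" for n x
        using uniform_limitD[OF unif, of "e / 2"] by (auto simp: eventually_sequentially dist_real_def)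
      have "norm ((SUP x. ?d (Suc n) (\<theta> n) x) - 0) < e" if "n \<ge> N" for n
      proof -
        have "(SUP x. ?d (Suc n) (\<theta> n) x) \<le> e / 2"
          using N[OF that] by (intro cSUP_least) (auto simp: cond_eq less_imp_le)
        with sup_nonneg[OF \<theta>, of n "Suc n"] e show ?thesis by simp
      qed
      then show "\<exists>N. \<forall>n\<ge>N. norm ((SUP x. ?d (Suc n) (\<theta> n) x) - 0) < e" by blast
    qed
  qed
  then show "(\<lambda>n. SUP \<theta>\<in>ell2. SUP x. ?d n \<theta> x) \<longlonglongrightarrow> 0"
    by (rule LIMSEQ_imp_Suc)
qed

end
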